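(* Let $\epsilon\in\{-1,1\}$ and let $r,r',s,s'$ be non-zero integers with $\gcd(r,r')=1$ and $\gcd(s,s')=1$. Let $A,B\in SL_2(\mathbb{C})$ be not simultaneously triangularizable. Then $A^{r}B^{s}A^{r'}B^{s'}=\epsilon I_2$ if and only if there exists $\alpha\in\{-1,1\}$ such that $$A^{r-r'}=\alpha I_2,\qquad B^{s-s'}=-\alpha\epsilon I_2\qquad\text{and}\qquad (A^{r}B^{s})^2=-I_2.$$
   Context: Two complex $2\times2$ matrices $A,B$ are simultaneously triangularizable if there is an invertible complex matrix $P$ such that $P^{-1}AP$ and $P^{-1}BP$ are both upper triangular. *)

theory Defs
  imports "HOL-Analysis.Analysis"
begin

(* The operations * and ^ on the type of vectors act componentwise, so powers with respect
   to the matrix product ** are introduced here. *)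
primrec mat_pow :: "'a::semiring_1^'n^'n \<Rightarrow> nat \<Rightarrow> 'a^'n^'n" where
  "mat_pow A 0 = mat 1"
| "mat_pow A (Suc n) = A ** mat_pow A n"

(* Meaningful for negative exponents only if A is invertible. *)
definition mat_zpow :: "'a::semiring_1^'n^'n \<Rightarrow> int \<Rightarrow> 'a^'n^'n" where
  "mat_zpow A k =
     (if 0 \<le> k then mat_pow A (nat k) else mat_pow (matrix_inv A) (nat (- k)))"

(* Entry M $ 2 $ 1 is the one in the second row and first column. The order of the index
   type 2 is not used, because 2 = 0 < 1 holds there. *)
definition upper_triangular2 :: "'a::zero^2^2 \<Rightarrow> bool" where
  "upper_triangular2 M \<longleftrightarrow> M $ 2 $ 1 = 0"

definition simultaneously_triangularizable :: "complex^2^2 \<Rightarrow> complex^2^2 \<Rightarrow> bool" where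
  "simultaneously_triangularizable A B \<longleftrightarrow>
     (\<exists>P :: complex^2^2. invertible P \<and>
        upper_triangular2 (matrix_inv P ** A ** P) \<and>
        upper_triangular2 (matrix_inv P ** B ** P))"

end

theory Submission
  imports Defs
begin

text \<open>Write \<open>X = A\<^sup>r\<close>, \<open>Y = B\<^sup>s\<close>. Coprimality of the exponents makes \<open>X\<close> and \<open>Y\<close> nonscalar, since
  otherwise a nonscalar power of one matrix would be a scalar multiple of a power of the other.
  Hence \<open>X\<close> and \<open>Y\<close> share no eigenvector, \<open>A\<^bsup>r'\<^esup> = p X + q\<close> and \<open>B\<^bsup>-s'\<^esup> = m Y + n\<close>. By
  Cayley--Hamilton \<open>X Y X = tr(X Y) X + Y - tr(Y)\<close>, so the word equation becomes a linear relation
  between \<open>1, X, Y, X Y\<close>. These are linearly independent, which forces \<open>q = 0\<close>, \<open>tr(X Y) = 0\<close> and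
  \<open>p = \<epsilon> m\<close>; determinants give \<open>p = \<plusminus>1\<close>, and \<open>\<alpha> = p\<close>.\<close>

section \<open>Integer powers of an invertible matrix\<close>

lemma invertible_mult_matrix_inv:
  assumes "invertible (A :: 'a::semiring_1^'n^'n)"
  shows "A ** matrix_inv A = mat 1" "matrix_inv A ** A = mat 1"
proof -
  have "\<exists>B. A ** B = mat 1 \<and> B ** A = mat 1"
    using assms by (auto simp: invertible_def)
  then have "A ** matrix_inv A = mat 1 \<and> matrix_inv A ** A = mat 1"
    unfolding matrix_inv_def by (rule someI_ex)
  then show "A ** matrix_inv A = mat 1" "matrix_inv A ** A = mat 1" by auto
qed

lemma mat_zpow_0: "mat_zpow A 0 = mat 1"
  by (simp add: mat_zpow_def)

lemma mat_zpow_1: "mat_zpow A 1 = A"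
  by (simp add: mat_zpow_def)

lemma mat_zpow_succ:
  fixes A :: "'a::semiring_1^'n^'n"
  assumes "invertible A"
  shows "mat_zpow A (k + 1) = A ** mat_zpow A k"
proof (cases "0 \<le> k")
  case True
  then show ?thesis by (simp add: mat_zpow_def nat_add_distrib)
next
  case False
  then obtain n where k: "k = - int (Suc n)"
    by (metis neg_int_cases not_le zero_less_imp_eq_int of_nat_0_less_iff gr0_implies_Suc)
  have "A ** mat_zpow A k = (A ** matrix_inv A) ** mat_pow (matrix_inv A) n"
    unfolding k mat_zpow_def by (simp add: matrix_mul_assoc nat_add_distrib del: of_nat_Suc)
  also have "\<dots> = mat_pow (matrix_inv A) n"
    by (simp add: invertible_mult_matrix_inv[OF assms])
  \<comment> \<open>For \<open>n = 0\<close> the exponent \<open>k + 1\<close> is 0 and leaves the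
    negative branch of the definition, hence the case split.\<close>
  also have "\<dots> = mat_zpow A (k + 1)"
    by (cases n) (auto simp: k mat_zpow_def nat_add_distrib)
  finally show ?thesis by simp
qed

lemma mat_zpow_pred:
  fixes A :: "'a::semiring_1^'n^'n"
  assumes "invertible A"
  shows "mat_zpow A (k - 1) = matrix_inv A ** mat_zpow A k"
  using mat_zpow_succ[OF assms, of "k - 1"]
  by (simp add: matrix_mul_assoc invertible_mult_matrix_inv[OF assms])

lemma mat_zpow_add:
  fixes A :: "'a::semiring_1^'n^'n"
  assumes "invertible A"
  shows "mat_zpow A (m + n) = mat_zpow A m ** mat_zpow A n"
proof (induction m rule: int_induct[where k = 0])
  case base
  show ?case by (simp add: mat_zpow_0)
next
  case (step1 i)
  have "mat_zpow A (i + 1 + n) = A ** mat_zpow A (i + n)"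
    using mat_zpow_succ[OF assms, of "i + n"] by (simp add: ac_simps)
  then show ?case
    by (simp add: step1 mat_zpow_succ[OF assms] matrix_mul_assoc)
next
  case (step2 i)
  have "mat_zpow A (i - 1 + n) = matrix_inv A ** mat_zpow A (i + n)"
    using mat_zpow_pred[OF assms, of "i + n"] by (simp add: algebra_simps)
  then show ?case
    by (simp add: step2 mat_zpow_pred[OF assms] matrix_mul_assoc)
qed

lemma mat_zpow_commute:
  fixes A :: "'a::semiring_1^'n^'n"
  assumes "invertible A"
  shows "mat_zpow A m ** mat_zpow A n = mat_zpow A n ** mat_zpow A m"
  by (metis add.commute assms mat_zpow_add)

lemma mat_zpow_commute1:
  fixes A :: "'a::semiring_1^'n^'n"
  assumes "invertible A"
  shows "mat_zpow A m ** A = A ** mat_zpow A m"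
  by (metis assms mat_zpow_commute mat_zpow_1)

lemma mat_zpow_minus:
  fixes A :: "'a::semiring_1^'n^'n"
  assumes "invertible A"
  shows "mat_zpow A m ** mat_zpow A (- m) = mat 1" "mat_zpow A (- m) ** mat_zpow A m = mat 1"
  using mat_zpow_add[OF assms, of m "- m"] mat_zpow_add[OF assms, of "- m" m]
  by (simp_all add: mat_zpow_0)

lemma det_mat_zpow:
  fixes A :: "'a::field^'n^'n"
  assumes "det A = 1"
  shows "det (mat_zpow A m) = 1"
proof -
  have inv: "invertible A" using assms by (simp add: invertible_det_nz)
  have "det A * det (matrix_inv A) = 1"
    by (metis det_mul det_I invertible_mult_matrix_inv(1)[OF inv])
  then have "det (matrix_inv A) = 1" using assms by simp
  moreover have "det (mat_pow C n) = 1" if "det C = 1" for C :: "'a^'n^'n" and n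
    using that by (induction n) (simp_all add: det_mul)
  ultimately show ?thesis using assms by (simp add: mat_zpow_def)
qed

section \<open>Scalar matrices and coprime exponents\<close>

lemma mat_mult_entry:
  fixes X :: "'a::semiring_1^'n^'n"
  shows "(mat a ** X)$i$j = a * X$i$j" "(X ** mat a)$i$j = X$i$j * a"
  by (simp_all add: matrix_matrix_mult_def mat_def if_distrib if_distribR cong: if_cong)

lemma mat_mult_mat: "mat a ** mat b = (mat (a * b) :: 'a::semiring_1^'n^'n)"
  by (simp add: vec_eq_iff mat_mult_entry) (simp add: mat_def)

lemma mat_mult_commute: "X ** mat a = mat a ** (X :: 'a::comm_semiring_1^'n^'n)"
  by (simp add: vec_eq_iff mat_mult_entry mult.commute)

lemma mat_mult_vec: "mat a *v x = a *s (x :: 'a::comm_semiring_1^'n)"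
  by (simp add: vec_eq_iff matrix_vector_mult_def mat_def if_distrib if_distribR cong: if_cong)

definition scalar_matrix :: "'a::semiring_1^'n^'n \<Rightarrow> bool" where
  "scalar_matrix M \<longleftrightarrow> (\<exists>c. M = mat c)"

text \<open>By Bezout, \<open>A\<close> is a product of integer powers of
  \<open>mat_zpow A r\<close> and \<open>mat_zpow A r'\<close>; scalar matrices are closed under
  products and, where invertible, under inverses.\<close>

lemma scalar_matrix_zpow_coprime:
  fixes A :: "'a::field^'n^'n"
  assumes inv: "invertible A" and gcd: "gcd r r' = 1"
    and sc: "scalar_matrix (mat_zpow A r)" "scalar_matrix (mat_zpow A r')"
  shows "scalar_matrix A"
proof -
  have mult: "scalar_matrix (M ** N)" if "scalar_matrix M" "scalar_matrix N"
    for M N :: "'a^'n^'n"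
    using that by (auto simp: scalar_matrix_def mat_mult_mat)
  have neg: "scalar_matrix (mat_zpow A (- m))" if sm: "scalar_matrix (mat_zpow A m)" for m
  proof -
    obtain c where c: "mat_zpow A m = mat c" using sm by (auto simp: scalar_matrix_def)
    have eq: "mat c ** mat_zpow A (- m) = mat 1" using mat_zpow_minus(1)[OF inv, of m] c by simp
    have "c \<noteq> 0"
    proof
      assume "c = 0"
      with eq have "(mat 1 :: 'a^'n^'n) = 0" by simp
      then have "(mat 1 :: 'a^'n^'n) $ i $ i = 0" for i by simp
      then show False by (simp add: mat_def)
    qed
    then have "mat_zpow A (- m) = mat (1 / c) ** (mat c ** mat_zpow A (- m))"
      by (simp add: matrix_mul_assoc mat_mult_mat)
    then show ?thesis by (simp add: eq scalar_matrix_def mat_mult_mat) blast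
  qed
  have times: "scalar_matrix (mat_zpow A (k * m))" if sm: "scalar_matrix (mat_zpow A m)" for k m
  proof (induction k rule: int_induct[where k = 0])
    case base
    show ?case by (auto simp: mat_zpow_0 scalar_matrix_def)
  next
    case (step1 i)
    then show ?case by (simp add: distrib_right mat_zpow_add[OF inv] mult sm)
  next
    case (step2 i)
    then show ?case
      using mat_zpow_add[OF inv, of "i * m" "- m"] mult neg[OF sm]
      by (simp add: left_diff_distrib)
  qed
  obtain u w where "u * r + w * r' = 1" using bezout_int[of r r'] gcd by auto
  then have "A = mat_zpow A (u * r) ** mat_zpow A (w * r')"
    by (metis mat_zpow_add[OF inv] mat_zpow_1)
  then show ?thesis using mult[OF times times] sc by metis
qed

section \<open>Common eigenvectors of two-by-two matrices\<close>

text \<open>Such a vector spans a line invariant under both matrices, which is simultaneous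
  triangularizability in dimension 2 without a choice of basis. This form passes easily to
  polynomials in the matrices.\<close>

definition common_eigenvector :: "complex^2^2 \<Rightarrow> complex^2^2 \<Rightarrow> bool" where
  "common_eigenvector X Y \<longleftrightarrow>
     (\<exists>v a b. v \<noteq> 0 \<and> X *v v = a *s v \<and> Y *v v = b *s v)"

lemma common_eigenvector_sym: "common_eigenvector X Y \<Longrightarrow> common_eigenvector Y X"
  by (auto simp: common_eigenvector_def)

lemmas entries2 = vec_eq_iff forall_2 sum_2 matrix_matrix_mult_def mat_def
  matrix_vector_mult_def vector_scalar_mult_def

lemma det_eq_0_iff_kernel:
  fixes M :: "'a::field^'n^'n"
  shows "det M = 0 \<longleftrightarrow> (\<exists>v. v \<noteq> 0 \<and> M *v v = 0)"
  using invertible_det_nz[of M] invertible_left_inverse[of M] matrix_left_invertible_ker[of M]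
  by auto

text \<open>The quadratic formula gives a root \<open>a\<close> of the characteristic polynomial, so
  \<open>X - mat a\<close> is singular and its kernel supplies the eigenvector.\<close>

lemma complex_eigenvector_exists:
  fixes X :: "complex^2^2"
  obtains v a where "v \<noteq> 0" "X *v v = a *s v"
proof -
  define t where "t = X$1$1 + X$2$2"
  define a where "a = (t + csqrt (t\<^sup>2 - 4 * det X)) / 2"
  have "2 * a - t = csqrt (t\<^sup>2 - 4 * det X)" by (simp add: a_def field_simps)
  then have "(2 * a - t)\<^sup>2 = t\<^sup>2 - 4 * det X" by simp
  then have "4 * (a\<^sup>2 - t * a + det X) = 0" by (simp add: power2_eq_square algebra_simps)
  then have "a\<^sup>2 - t * a + det X = 0" by (simp only: mult_eq_0_iff) simp
  then have "det (X - mat a) = 0"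
    by (simp add: det_2 t_def mat_def power2_eq_square algebra_simps)
  then obtain v where "v \<noteq> 0" "(X - mat a) *v v = 0"
    using det_eq_0_iff_kernel by blast
  then show ?thesis
    using that[of v a] by (simp add: matrix_vector_mult_diff_rdistrib mat_mult_vec)
qed

lemma common_eigenvector_imp_simultaneously_triangularizable:
  assumes "common_eigenvector A B"
  shows "simultaneously_triangularizable A B"
proof -
  obtain v a b where v: "v \<noteq> 0" "A *v v = a *s v" "B *v v = b *s v"
    using assms by (auto simp: common_eigenvector_def)
  \<comment> \<open>A unit vector independent of \<open>v\<close>: \<open>det P\<close> becomes
    \<open>- v$2\<close> or \<open>v$1\<close>, whichever is known to be nonzero.\<close>
  define w :: "complex^2" where "w = (if v$1 = 0 then vector [1, 0] else vector [0, 1])"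
  define P :: "complex^2^2" where "P = (\<chi> i j. if j = 1 then v$i else w$i)"
  have "det P \<noteq> 0" using v(1) by (auto simp: det_2 P_def w_def vec_eq_iff forall_2)
  then have inv: "invertible P" by (simp add: invertible_det_nz)
  define e :: "complex^2" where "e = vector [1, 0]"
  have Pe: "P *v e = v"
    by (simp add: P_def e_def matrix_vector_mult_def vec_eq_iff sum_2)
  have "(matrix_inv P ** M ** P)$2$1 = 0" if M: "M *v v = c *s v" for M c
  proof -
    have "matrix_inv P *v v = e"
      unfolding Pe[symmetric]
      by (simp add: matrix_vector_mul_assoc invertible_mult_matrix_inv[OF inv])
    then have "(matrix_inv P ** M ** P) *v e = c *s e"
      by (simp add: Pe M vector_scalar_commute flip: matrix_vector_mul_assoc)
    then have "((matrix_inv P ** M ** P) *v e)$2 = 0" by (simp add: e_def)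
    then show ?thesis
      by (simp add: matrix_vector_mult_def[of "matrix_inv P ** M ** P"] sum_2 e_def)
  qed
  then show ?thesis
    unfolding simultaneously_triangularizable_def upper_triangular2_def
    using inv v by blast
qed

section \<open>Commutants of nonscalar matrices and linear independence\<close>

text \<open>Attach to a matrix the triple of its two off-diagonal entries and its diagonal
  difference. Commuting means that the triples of \<open>X\<close> and \<open>Z\<close> are linearly
  dependent, and the triple of a nonscalar \<open>X\<close> is nonzero.\<close>

lemma commuting_nonscalar2:
  fixes X Z :: "'a::field^2^2"
  assumes comm: "X ** Z = Z ** X" and ns: "\<not> scalar_matrix X"
  obtains p q where "Z = mat p ** X + mat q"
proof -
  have entry: "X$i$1 * Z$1$j + X$i$2 * Z$2$j = Z$i$1 * X$1$j + Z$i$2 * X$2$j" for i j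
  proof -
    have "(X ** Z)$i$j = (Z ** X)$i$j" using comm by simp
    then show ?thesis by (simp add: matrix_matrix_mult_def sum_2)
  qed
  \<comment> \<open>These are the vanishing 2x2 minors of the two triples.\<close>
  have c1: "X$1$2 * Z$2$1 = Z$1$2 * X$2$1"
    and c2: "X$1$2 * (Z$1$1 - Z$2$2) = Z$1$2 * (X$1$1 - X$2$2)"
    and c3: "X$2$1 * (Z$1$1 - Z$2$2) = Z$2$1 * (X$1$1 - X$2$2)"
    using entry[of 1 1] entry[of 1 2] entry[of 2 1] by algebra+
  have div: "b = a / x * y" if "x \<noteq> 0" "x * b = a * y" for a b x y :: 'a
    using that by (simp add: field_simps)
  have "X$1$2 \<noteq> 0 \<or> X$2$1 \<noteq> 0 \<or> X$1$1 - X$2$2 \<noteq> 0"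
    using ns by (auto simp: scalar_matrix_def entries2)
  then obtain p where p: "Z$1$2 = p * X$1$2" "Z$2$1 = p * X$2$1"
      "Z$1$1 - Z$2$2 = p * (X$1$1 - X$2$2)"
  proof (elim disjE)
    assume "X$1$2 \<noteq> 0"
    then show thesis
      using c1 c2 by (intro that[of "Z$1$2 / X$1$2"] div) (simp_all add: mult.commute)
  next
    assume "X$2$1 \<noteq> 0"
    then show thesis
      using c1 c3 by (intro that[of "Z$2$1 / X$2$1"] div) (simp_all add: mult.commute)
  next
    assume "X$1$1 - X$2$2 \<noteq> 0"
    then show thesis
      using c2 c3 by (intro that[of "(Z$1$1 - Z$2$2) / (X$1$1 - X$2$2)"] div)
        (simp_all add: mult.commute)
  qed
  have "Z = mat p ** X + mat (Z$2$2 - p * X$2$2)"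
    using p by (simp add: entries2 algebra_simps)
  then show ?thesis by (rule that)
qed

lemma eigenvector_affine:
  fixes X :: "'a::field^'n^'n"
  assumes "X *v v = a *s v"
  shows "(mat p ** X + mat q) *v v = (p * a + q) *s v"
  using assms
  by (simp add: matrix_vector_mult_add_rdistrib mat_mult_vec vector_sadd_rdistrib
      flip: matrix_vector_mul_assoc)

text \<open>Both \<open>A\<close> and \<open>B\<close> are affine in \<open>X\<close>, so every
  eigenvector of \<open>X\<close> is an eigenvector of each.\<close>

lemma commuting_common_eigenvector:
  assumes "X ** A = A ** X" "X ** B = B ** X" "\<not> scalar_matrix X"
  shows "common_eigenvector A B"
proof -
  obtain p q where A: "A = mat p ** X + mat q" using commuting_nonscalar2 assms by metis
  obtain p' q' where B: "B = mat p' ** X + mat q'" using commuting_nonscalar2 assms by metis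
  obtain v a where "v \<noteq> 0" "X *v v = a *s v" by (rule complex_eigenvector_exists)
  then show ?thesis
    unfolding common_eigenvector_def A B using eigenvector_affine by blast
qed

lemma scalar_common_eigenvector:
  assumes "scalar_matrix A"
  shows "common_eigenvector A B"
proof -
  obtain c where "A = mat c" using assms by (auto simp: scalar_matrix_def)
  moreover obtain v a where "v \<noteq> 0" "B *v v = a *s v" by (rule complex_eigenvector_exists)
  ultimately show ?thesis unfolding common_eigenvector_def by (auto simp: mat_mult_vec)
qed

text \<open>Here \<open>A\<close> is affine in \<open>X\<close>, and \<open>B\<close> in
  \<open>Y\<close>. With nonscalar powers as \<open>X\<close> and \<open>Y\<close>, the absence of a
  common eigenvector passes from the matrices to their powers.\<close>

lemma common_eigenvector_of_commuting:
  assumes "common_eigenvector X Y" "\<not> scalar_matrix X" "\<not> scalar_matrix Y"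
    "X ** A = A ** X" "Y ** B = B ** Y"
  shows "common_eigenvector A B"
proof -
  obtain p q where A: "A = mat p ** X + mat q" using commuting_nonscalar2 assms by metis
  obtain p' q' where B: "B = mat p' ** Y + mat q'" using commuting_nonscalar2 assms by metis
  show ?thesis
    using assms(1) eigenvector_affine unfolding common_eigenvector_def A B by blast
qed

text \<open>Evaluating the relation at an eigenvector of \<open>Y\<close> for the eigenvalue \<open>m\<close> turns it into
  \<open>(c + d X) (Y - m) = 0\<close>, and the nonzero vectors in the image of \<open>Y - m\<close> are again eigenvectors
  of \<open>Y\<close>.\<close>

lemma linear_independent_1_X_Y_XY:
  assumes ne: "\<not> common_eigenvector X Y"
    and rel: "mat a + mat b ** X + mat c ** Y + mat d ** (X ** Y) = 0"
  shows "a = 0" "b = 0" "c = 0" "d = 0"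
proof -
  have rel_v: "a *s v + b *s (X *v v) + c *s (Y *v v) + d *s (X *v (Y *v v)) = 0" for v
  proof -
    have "(mat a + mat b ** X + mat c ** Y + mat d ** (X ** Y)) *v v = 0" using rel by simp
    then show ?thesis
      by (simp add: matrix_vector_mult_add_rdistrib mat_mult_vec flip: matrix_vector_mul_assoc)
  qed
  \<comment> \<open>An eigenvector \<open>v\<close> of \<open>Y\<close> and its image
    \<open>X *v v\<close> are independent, since otherwise \<open>v\<close> would be a common
    eigenvector.\<close>
  have dep: "p = 0 \<and> q = 0"
    if "v \<noteq> 0" "Y *v v = m *s v" "p *s v + q *s (X *v v) = 0" for v m p q
  proof -
    have "q = 0"
    proof (rule ccontr)
      assume "q \<noteq> 0"
      then have "X *v v = (- p / q) *s v"
        using that(3) by (simp add: vec_eq_iff field_simps eq_neg_iff_add_eq_0)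
      then show False using ne that(1,2) unfolding common_eigenvector_def by blast
    qed
    then show ?thesis using that(1,3) by (auto simp: vec_eq_iff)
  qed
  obtain v m where v: "v \<noteq> 0" "Y *v v = m *s v" by (rule complex_eigenvector_exists)
  have "(a + c * m) *s v + (b + d * m) *s (X *v v) = 0"
    using rel_v[of v] unfolding v(2)
    by (simp add: vec_eq_iff vector_scalar_commute algebra_simps)
  then have ab: "a + c * m = 0" "b + d * m = 0" using dep[OF v] by blast+
  have "\<not> scalar_matrix Y"
    using ne scalar_common_eigenvector common_eigenvector_sym by blast
  then have "Y - mat m \<noteq> 0" by (auto simp: scalar_matrix_def)
  then obtain u where "(Y - mat m) *v u \<noteq> 0"
    by (metis matrix_eq matrix_vector_mult_0)
  define w where "w = Y *v u - m *s u"
  have w: "w \<noteq> 0"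
    using \<open>(Y - mat m) *v u \<noteq> 0\<close>
    by (simp add: w_def matrix_vector_mult_diff_rdistrib mat_mult_vec)
  have "c *s w + d *s (X *v w) = 0"
  proof -
    have am: "a = - c * m" "b = - d * m" using ab by (simp_all add: add_eq_0_iff2)
    show ?thesis
      using rel_v[of u] unfolding am w_def
      by (simp add: vec_eq_iff matrix_vector_mult_diff_distrib vector_scalar_commute
          algebra_simps)
  qed
  \<comment> \<open>By Cayley-Hamilton, the image of \<open>Y - mat m\<close> is killed by
    \<open>Y\<close> minus its other eigenvalue, which is the trace minus \<open>m\<close>.\<close>
  moreover have "Y *v w = (Y$1$1 + Y$2$2 - m) *s w"
  proof -
    have "det (Y - mat m) = 0"
    proof -
      have "(Y - mat m) *v v = 0"
        using v by (simp add: matrix_vector_mult_diff_rdistrib mat_mult_vec)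
      then show ?thesis using v det_eq_0_iff_kernel by blast
    qed
    then have "(Y$1$1 - m) * (Y$2$2 - m) = Y$1$2 * Y$2$1" by (simp add: det_2 mat_def)
    then show ?thesis
      unfolding w_def by (simp add: entries2) algebra
  qed
  ultimately have "c = 0" "d = 0" using dep[OF w] by blast+
  then show "a = 0" "b = 0" "c = 0" "d = 0" using ab by auto
qed

section \<open>The word equation\<close>

text \<open>Otherwise \<open>mat_zpow A n\<close> would be a scalar multiple of a power of
  \<open>B\<close>, hence a nonscalar matrix commuting with both \<open>A\<close> and
  \<open>B\<close>. This rules out words in which one of the powers is scalar.\<close>

lemma word_ABA_nonscalar:
  assumes inv: "invertible A" "invertible B"
    and ne: "\<not> common_eigenvector A B" and ns: "\<not> scalar_matrix (mat_zpow A n)"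
  shows "mat_zpow B m ** mat_zpow A n ** mat_zpow B m' \<noteq> mat k"
proof
  assume eq: "mat_zpow B m ** mat_zpow A n ** mat_zpow B m' = mat k"
  have "mat_zpow A n = (mat_zpow B (- m) ** mat_zpow B m) ** mat_zpow A n **
      (mat_zpow B m' ** mat_zpow B (- m'))"
    by (simp add: mat_zpow_minus[OF inv(2)])
  also have "\<dots> = mat_zpow B (- m) ** (mat_zpow B m ** mat_zpow A n ** mat_zpow B m') **
      mat_zpow B (- m')"
    by (simp add: matrix_mul_assoc)
  also have "\<dots> = mat k ** mat_zpow B (- m + - m')"
    unfolding eq mat_zpow_add[OF inv(2), of "- m" "- m'"] mat_mult_commute
    by (simp add: matrix_mul_assoc)
  finally have X: "mat_zpow A n = mat k ** mat_zpow B (- m + - m')" .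
  have "mat_zpow A n ** B = B ** mat_zpow A n"
  proof -
    have "mat k ** (mat_zpow B (- m + - m') ** B) = mat k ** (B ** mat_zpow B (- m + - m'))"
      by (simp only: mat_zpow_commute1[OF inv(2)])
    then show ?thesis
      unfolding X matrix_mul_assoc mat_mult_commute[of B k] .
  qed
  then show False
    using commuting_common_eigenvector[OF mat_zpow_commute1[OF inv(1)] _ ns] ne by blast
qed

section \<open>Cayley-Hamilton and the linearized word equation\<close>

lemma cayley_hamilton2: "X ** X = mat (trace X) ** X - mat (det (X :: 'a::comm_ring_1^2^2))"
  by (simp add: entries2 trace_def det_2 algebra_simps)

text \<open>For invertible \<open>Y\<close> this is Cayley-Hamilton for \<open>X ** Y\<close> with a
  factor \<open>Y\<close> cancelled, because \<open>mat (trace Y) - Y\<close> is the adjugate of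
  \<open>Y\<close>.\<close>

lemma matrix_mult_XYX:
  fixes X Y :: "'a::comm_ring_1^2^2"
  assumes "det X = 1"
  shows "X ** Y ** X = mat (trace (X ** Y)) ** X + Y - mat (trace Y)"
proof -
  \<comment> \<open>With \<open>det X\<close> kept as a factor, this is a polynomial identity in the
    entries.\<close>
  have "X ** Y ** X = mat (trace (X ** Y)) ** X + mat (det X) ** (Y - mat (trace Y))"
    by (simp add: entries2 trace_def det_2 algebra_simps)
  then show ?thesis by (simp add: assms)
qed

text \<open>\<open>Z\<close> stands for the inverse of the last factor of the word. Since
  \<open>X'\<close> and \<open>Z\<close> are affine in \<open>X\<close> and \<open>Y\<close>, the
  equation is linear in 1, \<open>X\<close>, \<open>Y\<close> and \<open>X ** Y\<close>, and its
  coefficients can be compared.\<close>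

lemma word_XYXY:
  fixes X Y X' Z :: "complex^2^2"
  assumes det: "det X = 1" "det X' = 1" and e: "e * e = 1"
    and ne: "\<not> common_eigenvector X Y"
    and comm: "X ** X' = X' ** X" "Y ** Z = Z ** Y"
    and eq: "X ** Y ** X' = mat e ** Z"
  obtains p where "p \<in> {-1, 1}" "X' = mat p ** X" "trace (X ** Y) = 0"
    "Z = mat (e * p) ** (Y - mat (trace Y))"
proof -
  have nsX: "\<not> scalar_matrix X" using ne scalar_common_eigenvector by blast
  have nsY: "\<not> scalar_matrix Y"
    using ne scalar_common_eigenvector common_eigenvector_sym by blast
  obtain p q where X': "X' = mat p ** X + mat q" using commuting_nonscalar2[OF comm(1) nsX] .
  obtain m n where Z: "Z = mat m ** Y + mat n" using commuting_nonscalar2[OF comm(2) nsY] .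
  let ?z = "trace (X ** Y)"
  have "mat p ** (X ** Y ** X) + mat q ** (X ** Y) = mat e ** (mat m ** Y + mat n)"
    using eq unfolding X' Z
    by (simp add: matrix_add_ldistrib mat_mult_commute[of "X ** Y" q] matrix_mul_assoc
        mat_mult_commute[of "X ** Y" p])
  then have "mat p ** (mat ?z ** X + Y - mat (trace Y)) + mat q ** (X ** Y)
      = mat e ** (mat m ** Y + mat n)"
    by (simp add: matrix_mult_XYX[OF det(1)])
  then have "mat (- p * trace Y - e * n) + mat (p * ?z) ** X + mat (p - e * m) ** Y
      + mat q ** (X ** Y) = 0"
    unfolding vec_eq_iff by (simp add: mat_mult_entry) (simp add: mat_def algebra_simps)
  from linear_independent_1_X_Y_XY[OF ne this]
  have lin: "- p * trace Y - e * n = 0" "p * ?z = 0" "p - e * m = 0" "q = 0" by auto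
  have X'p: "X' = mat p ** X" using X' lin(4) by simp
  \<comment> \<open>The determinant is quadratic in dimension 2, which pins \<open>p\<close> down to
    a sign.\<close>
  have "det X' = p * p * det X" by (simp add: X'p det_2 entries2 algebra_simps)
  then have pp: "p * p = 1" using det by simp
  then have p: "p \<in> {-1, 1}" by (simp add: square_eq_1_iff disj_commute)
  moreover have "?z = 0" using lin(2) pp by auto
  moreover have "m = e * p" "n = - e * p * trace Y"
    using lin e by algebra+
  then have "Z = mat (e * p) ** (Y - mat (trace Y))"
    unfolding Z by (simp add: entries2 algebra_simps)
  ultimately show ?thesis using that X'p by blast
qed

section \<open>Solutions of the word equation\<close>

lemma word_solution:
  fixes A B :: "complex^2^2" and \<epsilon> :: complex
  assumes e: "\<epsilon> * \<epsilon> = 1" and gcd: "gcd r r' = 1" "gcd s s' = 1"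
    and det: "det A = 1" "det B = 1" and ns: "\<not> simultaneously_triangularizable A B"
    and eq: "mat_zpow A r ** mat_zpow B s ** mat_zpow A r' ** mat_zpow B s' = mat \<epsilon>"
  obtains \<alpha> where "\<alpha> \<in> {-1, 1}" "mat_zpow A (r - r') = mat \<alpha>"
    "mat_zpow B (s - s') = mat (- \<alpha> * \<epsilon>)"
    "mat_pow (mat_zpow A r ** mat_zpow B s) 2 = - mat 1"
proof -
  have inv: "invertible A" "invertible B" using det by (simp_all add: invertible_det_nz)
  have ne: "\<not> common_eigenvector A B"
    using ns common_eigenvector_imp_simultaneously_triangularizable by blast
  then have ne': "\<not> common_eigenvector B A" using common_eigenvector_sym by blast
  define X where "X = mat_zpow A r"
  define Y where "Y = mat_zpow B s"
  define X' where "X' = mat_zpow A r'"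
  \<comment> \<open>The negative exponent moves the last factor of the word to the right-hand
    side.\<close>
  define Z where "Z = mat_zpow B (- s')"
  have dets: "det X = 1" "det X' = 1" "det Y = 1"
    by (simp_all add: X_def X'_def Y_def det det_mat_zpow)
  \<comment> \<open>If \<open>X\<close> were scalar, coprimality would make
    \<open>mat_zpow A r'\<close> nonscalar, while the word would reduce to a scalar product with
    that power between two powers of \<open>B\<close>.\<close>
  have nsX: "\<not> scalar_matrix X"
  proof
    assume sX: "scalar_matrix X"
    then obtain c where c: "X = mat c" by (auto simp: scalar_matrix_def)
    have "c \<noteq> 0" using dets(1) c by (auto simp: det_2 mat_def)
    have "\<not> scalar_matrix (mat_zpow A r')"
      using scalar_matrix_zpow_coprime[OF inv(1) gcd(1)] sX ne scalar_common_eigenvector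
      unfolding X_def by blast
    moreover have "Y ** mat_zpow A r' ** mat_zpow B s' = mat (\<epsilon> / c)"
    proof -
      have "mat (1 / c) ** (mat c ** Y ** mat_zpow A r' ** mat_zpow B s') = mat (\<epsilon> / c)"
        using eq c by (simp add: X_def Y_def mat_mult_mat)
      then show ?thesis using \<open>c \<noteq> 0\<close> by (simp add: matrix_mul_assoc mat_mult_mat)
    qed
    ultimately show False using word_ABA_nonscalar[OF inv ne] unfolding Y_def by blast
  qed
  have nsY: "\<not> scalar_matrix Y"
  proof
    assume sY: "scalar_matrix Y"
    then obtain c where c: "Y = mat c" by (auto simp: scalar_matrix_def)
    have "c \<noteq> 0" using dets(3) c by (auto simp: det_2 mat_def)
    have "\<not> scalar_matrix (mat_zpow B s')"
      using scalar_matrix_zpow_coprime[OF inv(2) gcd(2)] sY ne' scalar_common_eigenvector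
      unfolding Y_def by blast
    \<comment> \<open>Around a scalar \<open>Y\<close> the two powers of \<open>A\<close> merge; the
      trailing \<open>mat_zpow A 0\<close> is the identity and supplies the third factor.\<close>
    moreover have "mat_zpow A (r + r') ** mat_zpow B s' ** mat_zpow A 0 = mat (\<epsilon> / c)"
    proof -
      have "mat (1 / c) ** (X ** mat c ** X' ** mat_zpow B s') = mat (\<epsilon> / c)"
        using eq c by (simp add: X_def X'_def Y_def mat_mult_mat)
      then show ?thesis
        using \<open>c \<noteq> 0\<close> unfolding mat_mult_commute[of X]
        by (simp add: matrix_mul_assoc mat_mult_mat mat_zpow_0 mat_zpow_add[OF inv(1)]
            X_def X'_def)
    qed
    ultimately show False using word_ABA_nonscalar[OF inv(2,1) ne'] by blast
  qed
  have neXY: "\<not> common_eigenvector X Y"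
    using common_eigenvector_of_commuting[OF _ nsX nsY, of A B] ne mat_zpow_commute1 inv
    unfolding X_def Y_def by blast
  have comm: "X ** X' = X' ** X" "Y ** Z = Z ** Y"
    unfolding X_def X'_def Y_def Z_def using inv by (simp_all add: mat_zpow_commute)
  have "X ** Y ** X' ** (mat_zpow B s' ** Z) = mat \<epsilon> ** Z"
    using eq by (simp add: X_def Y_def X'_def matrix_mul_assoc)
  then have "X ** Y ** X' = mat \<epsilon> ** Z"
    by (simp add: Z_def mat_zpow_minus[OF inv(2)])
  then obtain p where p: "p \<in> {-1, 1}" "X' = mat p ** X" "trace (X ** Y) = 0"
    "Z = mat (\<epsilon> * p) ** (Y - mat (trace Y))"
    using word_XYXY[OF dets(1,2) e neXY comm] by metis
  have pp: "p * p = 1" using p(1) by auto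
  have "mat_zpow A (r - r') = mat p"
  proof -
    have "mat p ** mat_zpow A (r - r') = X' ** mat_zpow A (- r')"
      using mat_zpow_add[OF inv(1), of r "- r'"] by (simp add: p(2) X_def matrix_mul_assoc)
    also have "\<dots> = mat 1" by (simp add: X'_def mat_zpow_minus[OF inv(1)])
    finally have "mat p ** (mat p ** mat_zpow A (r - r')) = mat p" by simp
    then show ?thesis by (simp add: matrix_mul_assoc mat_mult_mat pp)
  qed
  moreover have "mat_zpow B (s - s') = mat (- p * \<epsilon>)"
  proof -
    \<comment> \<open>Cayley-Hamilton turns \<open>Y ** Y - mat (trace Y) ** Y\<close> into minus
      the determinant, so the product is scalar.\<close>
    have "mat_zpow B (s - s') = Y ** Z"
      using mat_zpow_add[OF inv(2), of s "- s'"] by (simp add: Y_def Z_def)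
    also have "\<dots> = mat (\<epsilon> * p) ** (Y ** Y - mat (trace Y) ** Y)"
      by (simp add: p(4) entries2 algebra_simps)
    also have "\<dots> = mat (- p * \<epsilon>)"
      unfolding cayley_hamilton2[of Y] dets(3) by (simp add: entries2)
    finally show ?thesis .
  qed
  \<comment> \<open>A matrix of trace 0 and determinant 1 squares to minus the identity.\<close>
  moreover have "mat_pow (X ** Y) 2 = - mat 1"
    using cayley_hamilton2[of "X ** Y"] p(3) dets by (simp add: numeral_2_eq_2 det_mul)
  ultimately show ?thesis using that p(1) unfolding X_def Y_def by blast
qed

theorem proposition7:
  fixes A B :: "complex^2^2" and \<epsilon> :: complex and r r' s s' :: int
  assumes "\<epsilon> \<in> {-1, 1}"
    and "r \<noteq> 0" and "r' \<noteq> 0" and "s \<noteq> 0" and "s' \<noteq> 0"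
    and "gcd r r' = 1" and "gcd s s' = 1"
    and "det A = 1" and "det B = 1"
    and "\<not> simultaneously_triangularizable A B"
  shows "mat_zpow A r ** mat_zpow B s ** mat_zpow A r' ** mat_zpow B s' = mat \<epsilon> \<longleftrightarrow>
    (\<exists>\<alpha> \<in> {-1, 1 :: complex}.
       mat_zpow A (r - r') = mat \<alpha> \<and>
       mat_zpow B (s - s') = mat (- \<alpha> * \<epsilon>) \<and>
       mat_pow (mat_zpow A r ** mat_zpow B s) 2 = - mat 1)" (is "?word \<longleftrightarrow> ?cond")
proof
  have e: "\<epsilon> * \<epsilon> = 1" using assms(1) by auto
  show ?cond if ?word
    using word_solution[OF e assms(6-10) that] by metis
  show ?word if ?cond
  proof -
    have inv: "invertible A" "invertible B" using assms(8,9) by (simp_all add: invertible_det_nz)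
    from that obtain \<alpha> where "\<alpha> \<in> {-1, 1}" and \<alpha>: "mat_zpow A (r - r') = mat \<alpha>"
      "mat_zpow B (s - s') = mat (- \<alpha> * \<epsilon>)"
      "mat_pow (mat_zpow A r ** mat_zpow B s) 2 = - mat 1" by blast
    then have aa: "\<alpha> * \<alpha> = 1" by auto
    let ?X = "mat_zpow A r" and ?Y = "mat_zpow B s"
    \<comment> \<open>As \<alpha> is its own inverse, the scalar value of
      \<open>mat_zpow A (r - r')\<close> expresses \<open>mat_zpow A r'\<close> through
      \<open>?X\<close>; the same works for \<open>B\<close>.\<close>
    have "mat \<alpha> ** ?X = mat \<alpha> ** (mat \<alpha> ** mat_zpow A r')"
      using mat_zpow_add[OF inv(1), of "r - r'" r'] \<alpha>(1) by simp
    then have A': "mat_zpow A r' = mat \<alpha> ** ?X"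
      by (simp add: matrix_mul_assoc mat_mult_mat aa)
    have "mat (- \<alpha> * \<epsilon>) ** ?Y = mat (- \<alpha> * \<epsilon>) ** (mat (- \<alpha> * \<epsilon>) ** mat_zpow B s')"
      using mat_zpow_add[OF inv(2), of "s - s'" s'] \<alpha>(2) by simp
    moreover have "(- \<alpha> * \<epsilon>) * (- \<alpha> * \<epsilon>) = 1" using e aa by algebra
    ultimately have B': "mat_zpow B s' = mat (- \<alpha> * \<epsilon>) ** ?Y"
      by (simp add: matrix_mul_assoc mat_mult_mat)
    \<comment> \<open>Collecting the scalars in front leaves \<open>- \<epsilon>\<close> times the
      square of \<open>?X ** ?Y\<close>.\<close>
    have "?X ** ?Y ** mat_zpow A r' ** mat_zpow B s'
        = (?X ** ?Y ** mat \<alpha>) ** (?X ** mat (- \<alpha> * \<epsilon>)) ** ?Y"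
      unfolding A' B' by (simp add: matrix_mul_assoc)
    also have "\<dots> = mat \<alpha> ** (?X ** ?Y ** mat (- \<alpha> * \<epsilon>)) ** (?X ** ?Y)"
      unfolding mat_mult_commute[of "?X ** ?Y" \<alpha>] mat_mult_commute[of ?X "- \<alpha> * \<epsilon>"]
      by (simp add: matrix_mul_assoc)
    also have "\<dots> = mat (\<alpha> * (- \<alpha> * \<epsilon>)) ** mat_pow (?X ** ?Y) 2"
      unfolding mat_mult_commute[of "?X ** ?Y" "- \<alpha> * \<epsilon>"]
      by (simp add: numeral_2_eq_2 matrix_mul_assoc mat_mult_mat)
    also have "\<alpha> * (- \<alpha> * \<epsilon>) = - \<epsilon>" using aa by algebra
    also have "mat (- \<epsilon>) ** mat_pow (?X ** ?Y) 2 = mat \<epsilon>"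
      unfolding \<alpha>(3) by (simp add: entries2)
    finally show ?thesis .
  qed
qed

end
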